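(* Let $E$ be a non-empty finite set, let $F$ be a hyperfield, and let $\mathcal{C}\subseteq F^E$ satisfy: (C0) $0\notin\mathcal{C}$; (C1) if $X\in\mathcal{C}$ and $\alpha\in F^\times$ then $\alpha\odot X\in\mathcal{C}$; (C2) if $X,Y\in\mathcal{C}$ and $\underline{X}\subseteq\underline{Y}$ then $X=\alpha\odot Y$ for some $\alpha\in F^\times$. Then the following two conditions are equivalent: (C3) [Strong modular elimination] Whenever $X_1,\dots,X_k,X\in\mathcal{C}$ together form a modular family of size $k+1$ with $\underline{X}\not\subseteq\bigcup_{1\le i\le k}\underline{X}_i$, and for $1\le i\le k$ elements $e_i\in(\underline{X}\cap\underline{X}_i)\setminus\bigcup_{j\ne i}\underline{X}_j$ are chosen with $X(e_i)=-X_i(e_i)\neq 0$, there exists $Z\in\mathcal{C}$ such that $Z(e_i)=0$ for $1\le i\le k$ and $Z(f)\in X(f)\boxplus X_1(f)\boxplus\cdots\boxplus X_k(f)$ for every $f\in E$. (C3)'' The set of supports $\{\underline{X}: X\in\mathcal{C}\}$ is the set of circuits of a matroid $\underline{M}$ on $E$, and for every $X\in\mathcal{C}$ and every basis $B$ of $\underline{M}$, $X$ lies in the linear span of the vectors $X_{B,e}$ for $e\in E\setminus B$, where $X_{B,e}$ denotes the unique element of $\mathcal{C}$ with $X_{B,e}(e)=1$ whose support is the fundamental circuit of $e$ with respect to $B$.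
   Context: A hyperfield $F$ has multiplication $\odot$ and multivalued commutative, associative addition $\boxplus$ (with hyperinverses $-x$ characterized by $0\in x\boxplus -x$); $F^E$ is the set of functions $E\to F$ with pointwise operations, and the support $\underline{X}$ of $X\in F^E$ is $\{e\in E: X(e)\neq 0\}$. For the lattice $U$ of all unions of supports of elements of $\mathcal{C}$ (ordered by inclusion), a family of elements of $\mathcal{C}$ is modular if the height in $U$ of the union of their supports equals the size of the family (supports being the atoms of $U$). A vector $Y\in F^E$ is in the linear span of $Y_1,\dots,Y_k\in F^E$ if $Y\in (c_1\odot Y_1)\boxplus\cdots\boxplus(c_k\odot Y_k)$ for some $c_1,\dots,c_k\in F$; equivalently here, $X(f)\in\bigoplus_{e\in E\setminus B}X(e)\odot X_{B,e}(f)$ for all $f\in E$. *)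

theory Defs
  imports "HOL-Library.Function_Algebras"
begin

section \<open>Hypergroups and hyperfields\<close>

class comm_hypergroup = zero + uminus +
  fixes hyperadd :: "'a \<Rightarrow> 'a \<Rightarrow> 'a set"  (infixl "\<boxplus>" 65)
  assumes hyperadd_nonempty: "x \<boxplus> y \<noteq> {}"
    and hyperadd_commute: "x \<boxplus> y = y \<boxplus> x"
    and hyperadd_assoc: "(\<Union>w\<in>x \<boxplus> y. w \<boxplus> z) = (\<Union>w\<in>y \<boxplus> z. x \<boxplus> w)"
    and hyperadd_zero: "0 \<boxplus> x = {x}"
    and zero_in_hyperadd_iff: "0 \<in> x \<boxplus> y \<longleftrightarrow> y = - x"
    and hyperadd_reversible: "x \<in> y \<boxplus> z \<longleftrightarrow> z \<in> x \<boxplus> (- y)"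

class hyperfield = comm_hypergroup + comm_monoid_mult + mult_zero + zero_neq_one +
  assumes mult_hyperadd: "(\<lambda>w. a * w) ` (x \<boxplus> y) = (a * x) \<boxplus> (a * y)"
    and nonzero_invertible: "a \<noteq> 0 \<Longrightarrow> \<exists>b. a * b = 1"

text \<open>Iterated hypersums are the big operator of the commutative monoid formed by the subsets of
  the hypergroup under \<open>A \<boxplus> B = \<Union>{a \<boxplus> b | a \<in> A, b \<in> B}\<close>, whose neutral element is \<open>{0}\<close>.\<close>

definition hyperadd_set :: "'a::comm_hypergroup set \<Rightarrow> 'a set \<Rightarrow> 'a set" where
  "hyperadd_set A B = (\<Union>a\<in>A. \<Union>b\<in>B. a \<boxplus> b)"

lemma hyperadd_set_assoc:
  "hyperadd_set (hyperadd_set A B) C = hyperadd_set A (hyperadd_set B C)"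
proof -
  have "hyperadd_set (hyperadd_set A B) C = (\<Union>a\<in>A. \<Union>b\<in>B. \<Union>c\<in>C. \<Union>w\<in>a \<boxplus> b. w \<boxplus> c)"
    unfolding hyperadd_set_def by blast
  also have "\<dots> = (\<Union>a\<in>A. \<Union>b\<in>B. \<Union>c\<in>C. \<Union>w\<in>b \<boxplus> c. a \<boxplus> w)"
    by (simp only: hyperadd_assoc)
  also have "\<dots> = hyperadd_set A (hyperadd_set B C)"
    unfolding hyperadd_set_def by blast
  finally show ?thesis .
qed

lemma hyperadd_set_commute: "hyperadd_set A B = hyperadd_set B A"
proof -
  have "hyperadd_set A B \<subseteq> hyperadd_set B A" for A B :: "'a set"
    unfolding hyperadd_set_def using hyperadd_commute by blast
  then show ?thesis by blast
qed

lemma hyperadd_set_zero: "hyperadd_set A {0} = A"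
  unfolding hyperadd_set_def by (simp add: hyperadd_commute[of _ 0] hyperadd_zero)

global_interpretation hypersum_set: comm_monoid_set hyperadd_set "{0 :: 'a::comm_hypergroup}"
  defines hypersum_set = hypersum_set.F
  by unfold_locales (fact hyperadd_set_assoc hyperadd_set_commute hyperadd_set_zero)+

definition hypersum :: "('i \<Rightarrow> 'a::comm_hypergroup) \<Rightarrow> 'i set \<Rightarrow> 'a set" where
  "hypersum x I = hypersum_set (\<lambda>i. {x i}) I"

section \<open>Vectors over a hyperfield\<close>

instantiation "fun" :: (type, comm_hypergroup) comm_hypergroup
begin

definition hyperadd_fun :: "('a \<Rightarrow> 'b) \<Rightarrow> ('a \<Rightarrow> 'b) \<Rightarrow> ('a \<Rightarrow> 'b) set" where
  "hyperadd_fun X Y = {Z. \<forall>e. Z e \<in> X e \<boxplus> Y e}"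

instance
proof
  fix X Y Z :: "'a \<Rightarrow> 'b"
  show "X \<boxplus> Y \<noteq> {}"
  proof -
    have "\<forall>e. \<exists>w. w \<in> X e \<boxplus> Y e" using hyperadd_nonempty by blast
    then have "\<exists>W. \<forall>e. W e \<in> X e \<boxplus> Y e" by (rule choice)
    then show ?thesis by (simp add: hyperadd_fun_def)
  qed
  show "X \<boxplus> Y = Y \<boxplus> X"
    unfolding hyperadd_fun_def using hyperadd_commute by blast
  show "(\<Union>W\<in>X \<boxplus> Y. W \<boxplus> Z) = (\<Union>W\<in>Y \<boxplus> Z. X \<boxplus> W)"
  proof (rule set_eqI)
    fix V
    have "V \<in> (\<Union>W\<in>X \<boxplus> Y. W \<boxplus> Z) \<longleftrightarrow> (\<exists>W. \<forall>e. W e \<in> X e \<boxplus> Y e \<and> V e \<in> W e \<boxplus> Z e)"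
      unfolding hyperadd_fun_def by blast
    also have "\<dots> \<longleftrightarrow> (\<forall>e. \<exists>w. w \<in> X e \<boxplus> Y e \<and> V e \<in> w \<boxplus> Z e)"
      by (rule choice_iff[symmetric])
    also have "\<dots> \<longleftrightarrow> (\<forall>e. V e \<in> (\<Union>w\<in>X e \<boxplus> Y e. w \<boxplus> Z e))"
      by blast
    also have "\<dots> \<longleftrightarrow> (\<forall>e. V e \<in> (\<Union>w\<in>Y e \<boxplus> Z e. X e \<boxplus> w))"
      by (simp only: hyperadd_assoc)
    also have "\<dots> \<longleftrightarrow> (\<forall>e. \<exists>w. w \<in> Y e \<boxplus> Z e \<and> V e \<in> X e \<boxplus> w)"
      by blast
    also have "\<dots> \<longleftrightarrow> (\<exists>W. \<forall>e. W e \<in> Y e \<boxplus> Z e \<and> V e \<in> X e \<boxplus> W e)"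
      by (rule choice_iff)
    also have "\<dots> \<longleftrightarrow> V \<in> (\<Union>W\<in>Y \<boxplus> Z. X \<boxplus> W)"
      unfolding hyperadd_fun_def by blast
    finally show "V \<in> (\<Union>W\<in>X \<boxplus> Y. W \<boxplus> Z) \<longleftrightarrow> V \<in> (\<Union>W\<in>Y \<boxplus> Z. X \<boxplus> W)" .
  qed
  show "0 \<boxplus> X = {X}"
    by (auto simp: hyperadd_fun_def hyperadd_zero fun_eq_iff)
  show "0 \<in> X \<boxplus> Y \<longleftrightarrow> Y = - X"
    by (auto simp: hyperadd_fun_def zero_in_hyperadd_iff fun_eq_iff)
  show "X \<in> Y \<boxplus> Z \<longleftrightarrow> Z \<in> X \<boxplus> (- Y)"
  proof -
    have "X e \<in> Y e \<boxplus> Z e \<longleftrightarrow> Z e \<in> X e \<boxplus> (- Y) e" for e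
      using hyperadd_reversible[of "X e" "Y e" "Z e"] by simp
    then show ?thesis by (simp add: hyperadd_fun_def)
  qed
qed

end

definition scale :: "'f::hyperfield \<Rightarrow> ('e \<Rightarrow> 'f) \<Rightarrow> ('e \<Rightarrow> 'f)"  (infixr "\<odot>" 75) where
  "\<alpha> \<odot> X = (\<lambda>e. \<alpha> * X e)"

definition support :: "('e \<Rightarrow> 'f::zero) \<Rightarrow> 'e set" where
  "support X = {e. X e \<noteq> 0}"

definition linear_span :: "('i \<Rightarrow> 'e \<Rightarrow> 'f::hyperfield) \<Rightarrow> 'i set \<Rightarrow> ('e \<Rightarrow> 'f) set" where
  "linear_span Y I = {V. \<exists>c. V \<in> hypersum (\<lambda>i. c i \<odot> Y i) I}"

section \<open>Modular families and strong modular elimination\<close>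

definition support_unions :: "('e \<Rightarrow> 'f::zero) set \<Rightarrow> 'e set set" where
  "support_unions \<C> = {\<Union>(support ` \<S>) |\<S>. \<S> \<subseteq> \<C>}"

text \<open>\<open>support_unions \<C>\<close> contains the empty union, so a longest chain below \<open>A\<close> starts at \<open>{}\<close>; the
  height counts the steps of the chain.\<close>

definition height :: "'a set set \<Rightarrow> 'a set \<Rightarrow> nat" where
  "height U A = (GREATEST n. \<exists>c :: nat \<Rightarrow> 'a set.
     (\<forall>i\<le>n. c i \<in> U) \<and> (\<forall>i<n. c i \<subset> c (Suc i)) \<and> c n = A)"

definition modular_family :: "('e \<Rightarrow> 'f::zero) set \<Rightarrow> ('i \<Rightarrow> 'e \<Rightarrow> 'f) \<Rightarrow> 'i set \<Rightarrow> bool" where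
  "modular_family \<C> X I \<longleftrightarrow> finite I \<and> X ` I \<subseteq> \<C> \<and>
     height (support_unions \<C>) (\<Union>i\<in>I. support (X i)) = card I"

text \<open>The vector from which \<open>X 1, \<dots>, X k\<close> eliminate the elements \<open>e 1, \<dots>, e k\<close> is \<open>X 0\<close>.\<close>

definition strong_modular_elimination :: "('e \<Rightarrow> 'f::hyperfield) set \<Rightarrow> bool" where
  "strong_modular_elimination \<C> \<longleftrightarrow>
     (\<forall>(k::nat) (X :: nat \<Rightarrow> 'e \<Rightarrow> 'f) (e :: nat \<Rightarrow> 'e).
        modular_family \<C> X {0..k} \<longrightarrow>
        \<not> support (X 0) \<subseteq> (\<Union>i\<in>{1..k}. support (X i)) \<longrightarrow>
        (\<forall>i\<in>{1..k}. e i \<in> (support (X 0) \<inter> support (X i)) - (\<Union>j\<in>{1..k} - {i}. support (X j))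
           \<and> X 0 (e i) = - X i (e i) \<and> - X i (e i) \<noteq> 0) \<longrightarrow>
        (\<exists>Z\<in>\<C>. (\<forall>i\<in>{1..k}. Z (e i) = 0) \<and> (\<forall>f. Z f \<in> hypersum (\<lambda>i. X i f) {0..k})))"

section \<open>Matroids and spanning by fundamental circuits\<close>

locale matroid =
  fixes ground :: "'e set" and indep :: "'e set \<Rightarrow> bool"
  assumes finite_ground: "finite ground"
    and indep_subset_ground: "indep I \<Longrightarrow> I \<subseteq> ground"
    and indep_empty: "indep {}"
    and indep_mono: "indep J \<Longrightarrow> I \<subseteq> J \<Longrightarrow> indep I"
    and indep_augment: "indep I \<Longrightarrow> indep J \<Longrightarrow> card I < card J \<Longrightarrow> \<exists>x\<in>J - I. indep (insert x I)"
begin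

definition circuit :: "'e set \<Rightarrow> bool" where
  "circuit C \<longleftrightarrow> C \<subseteq> ground \<and> \<not> indep C \<and> (\<forall>D. D \<subset> C \<longrightarrow> indep D)"

definition basis :: "'e set \<Rightarrow> bool" where
  "basis B \<longleftrightarrow> indep B \<and> (\<forall>J. indep J \<longrightarrow> B \<subseteq> J \<longrightarrow> J = B)"

definition fundamental_circuit :: "'e set \<Rightarrow> 'e \<Rightarrow> 'e set" where
  "fundamental_circuit B e = (THE C. circuit C \<and> C \<subseteq> insert e B)"

end

definition fundamental_vector ::
    "('e set \<Rightarrow> bool) \<Rightarrow> ('e \<Rightarrow> 'f::hyperfield) set \<Rightarrow> 'e set \<Rightarrow> 'e \<Rightarrow> 'e \<Rightarrow> 'f" where
  "fundamental_vector indep \<C> B e =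
     (THE Y. Y \<in> \<C> \<and> Y e = 1 \<and> support Y = matroid.fundamental_circuit UNIV indep B e)"

definition spanned_by_fundamental_vectors :: "('e::finite \<Rightarrow> 'f::hyperfield) set \<Rightarrow> bool" where
  "spanned_by_fundamental_vectors \<C> \<longleftrightarrow>
     (\<exists>indep. matroid UNIV indep \<and>
        support ` \<C> = {C. matroid.circuit UNIV indep C} \<and>
        (\<forall>X\<in>\<C>. \<forall>B. matroid.basis indep B \<longrightarrow>
           X \<in> linear_span (fundamental_vector indep \<C> B) (UNIV - B)))"

end

theory Submission
  imports Defs
begin

text \<open>The matroid in the implication from strong modular elimination comes from the weak circuit
  elimination axiom: if a pair of circuits is not modular, some pair of distinct circuits has a
  strictly smaller union, so by induction only modular pairs matter, and these are the case \<open>k = 1\<close>.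
  Given a vector \<open>X\<close> and a basis \<open>B\<close> with \<open>support X - B = {e 0, \<dots>, e k}\<close>, strong modular elimination
  of \<open>e 1, \<dots>, e k\<close> from \<open>X\<close> by the vectors \<open>- X (e i) \<odot> X\<^bsub>B, e i\<^esub>\<close> leaves a vector supported on the
  fundamental circuit of \<open>e 0\<close>, which is \<open>X (e 0) \<odot> X\<^bsub>B, e 0\<^esub>\<close>; reversibility of the hypersum turns
  this into the expansion of \<open>X\<close>.

  Conversely, in a modular family the union of the supports minus \<open>{e 0, \<dots>, e k}\<close>, where \<open>e 0\<close> lies
  in the support of \<open>X 0\<close> only, is independent, hence contained in a basis \<open>B\<close>.  The \<open>X i\<close> with \<open>i \<ge> 1\<close>
  are multiples of fundamental vectors for \<open>B\<close>, and the expansion of \<open>X 0\<close> read backwards exhibits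
  \<open>X 0 (e 0) \<odot> X\<^bsub>B, e 0\<^esub>\<close> as the eliminating vector.\<close>

section \<open>Hypergroups and hypersums\<close>

lemma hyper_minus_minus [simp]: "- (- x) = (x :: 'a::comm_hypergroup)"
  using zero_in_hyperadd_iff[of x "- x"] zero_in_hyperadd_iff[of "- x" x]
  by (simp add: hyperadd_commute)

lemma hyper_minus_zero [simp]: "- 0 = (0 :: 'a::comm_hypergroup)"
  using zero_in_hyperadd_iff[of 0 "0 :: 'a"] by (simp add: hyperadd_zero)

lemma hyper_minus_eq_zero_iff [simp]: "- x = 0 \<longleftrightarrow> x = (0 :: 'a::comm_hypergroup)"
  by (metis hyper_minus_minus hyper_minus_zero)

text \<open>Reversing \<open>x \<in> y \<boxplus> z\<close> puts \<open>0\<close> into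
  \<open>(x \<boxplus> - y) \<boxplus> - z\<close>. Associativity then gives some
  \<open>w \<in> - y \<boxplus> - z\<close> with \<open>0 \<in> x \<boxplus> w\<close>, and
  uniqueness of hyperinverses forces \<open>w = - x\<close>.\<close>

lemma hyperadd_minus:
  fixes x :: "'a::comm_hypergroup"
  assumes "x \<in> y \<boxplus> z"
  shows "- x \<in> (- y) \<boxplus> (- z)"
proof -
  have "z \<in> x \<boxplus> (- y)"
    using assms hyperadd_reversible by blast
  moreover have "0 \<in> z \<boxplus> (- z)"
    by (simp add: zero_in_hyperadd_iff)
  ultimately have "0 \<in> (\<Union>w\<in>x \<boxplus> (- y). w \<boxplus> (- z))"
    by blast
  then obtain w where "w \<in> (- y) \<boxplus> (- z)" "0 \<in> x \<boxplus> w"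
    by (auto simp: hyperadd_assoc)
  then show ?thesis
    by (simp add: zero_in_hyperadd_iff)
qed

lemma hypersum_empty [simp]: "hypersum x {} = {0}"
  by (simp add: hypersum_def)

lemma hypersum_insert:
  "finite I \<Longrightarrow> i \<notin> I \<Longrightarrow> hypersum x (insert i I) = (\<Union>s\<in>hypersum x I. x i \<boxplus> s)"
  by (simp add: hypersum_def hyperadd_set_def)

lemma hypersum_cong:
  "I = J \<Longrightarrow> (\<And>i. i \<in> J \<Longrightarrow> x i = y i) \<Longrightarrow> hypersum x I = hypersum y J"
  unfolding hypersum_def by (rule hypersum_set.cong) auto

lemma hypersum_mono_neutral:
  assumes "finite J" "I \<subseteq> J" "\<And>i. i \<in> J - I \<Longrightarrow> x i = 0"
  shows "hypersum x J = hypersum x I"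
  unfolding hypersum_def using assms by (intro hypersum_set.mono_neutral_right) auto

lemma hypersum_reindex:
  assumes "bij_betw h I J"
  shows "hypersum (\<lambda>i. x (h i)) I = hypersum x J"
  unfolding hypersum_def using hypersum_set.reindex_bij_betw[OF assms, of "\<lambda>i. {x i}"] by simp

lemma hypersum_zero:
  assumes "finite I" "\<And>i. i \<in> I \<Longrightarrow> x i = 0"
  shows "hypersum x I = {0}"
  using hypersum_mono_neutral[of I "{}" x] assms by auto

lemma hypersum_single:
  assumes "finite I" "i \<in> I" "\<And>j. j \<in> I \<Longrightarrow> j \<noteq> i \<Longrightarrow> x j = 0"
  shows "hypersum x I = {x i}"
proof -
  have "hypersum x I = hypersum x {i}"
    using assms by (intro hypersum_mono_neutral) auto
  then show ?thesis
    by (simp add: hypersum_insert hyperadd_commute[of _ 0] hyperadd_zero)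
qed

lemma hypersum_minus:
  assumes "finite I" "s \<in> hypersum x I"
  shows "- s \<in> hypersum (\<lambda>i. - x i) I"
  using assms
proof (induction I arbitrary: s)
  case (insert i I)
  then obtain t where "t \<in> hypersum x I" "s \<in> x i \<boxplus> t"
    by (auto simp: hypersum_insert)
  then show ?case
    using insert hyperadd_minus[of s "x i" t] by (auto simp: hypersum_insert)
qed simp

text \<open>Reversibility for long sums: \<open>x i\<close> and \<open>y i\<close> trade places
  while the remaining summands change sign. Both directions of the theorem use it to pass between an
  elimination and an expansion.\<close>

lemma hypersum_exchange:
  assumes "finite I" "i \<notin> I" "x i \<in> hypersum y (insert i I)" "\<And>j. j \<in> I \<Longrightarrow> y j = - x j"
  shows "y i \<in> hypersum x (insert i I)"
proof -
  obtain s where s: "s \<in> hypersum y I" "x i \<in> y i \<boxplus> s"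
    using assms by (auto simp: hypersum_insert)
  \<comment> \<open>The reversibility axiom isolates the second summand, so \<open>y i\<close> has
    to be moved there first.\<close>
  have "x i \<in> s \<boxplus> y i"
    using s(2) hyperadd_commute by blast
  then have "y i \<in> x i \<boxplus> (- s)"
    using hyperadd_reversible by blast
  moreover have "- s \<in> hypersum x I"
    using hypersum_minus[OF assms(1) s(1)] assms(4)
      hypersum_cong[of I I "\<lambda>j. - y j" x] by simp
  ultimately show ?thesis
    using assms by (auto simp: hypersum_insert)
qed

text \<open>The partial sums can be chosen independently at each coordinate, and the axiom of choice
  assembles these choices into one intermediate vector.\<close>

lemma hypersum_fun_iff:
  fixes X :: "'i \<Rightarrow> 'e \<Rightarrow> 'a::comm_hypergroup"
  assumes "finite I"
  shows "V \<in> hypersum X I \<longleftrightarrow> (\<forall>e. V e \<in> hypersum (\<lambda>i. X i e) I)"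
  using assms
proof (induction I arbitrary: V)
  case empty
  then show ?case by (auto simp: fun_eq_iff)
next
  case (insert i I)
  have "V \<in> hypersum X (insert i I) \<longleftrightarrow>
      (\<exists>S. \<forall>e. S e \<in> hypersum (\<lambda>i. X i e) I \<and> V e \<in> X i e \<boxplus> S e)"
    using insert by (auto simp: hypersum_insert hyperadd_fun_def)
  also have "\<dots> \<longleftrightarrow> (\<forall>e. \<exists>s. s \<in> hypersum (\<lambda>i. X i e) I \<and> V e \<in> X i e \<boxplus> s)"
    by (rule choice_iff[symmetric])
  also have "\<dots> \<longleftrightarrow> (\<forall>e. V e \<in> hypersum (\<lambda>i. X i e) (insert i I))"
    using insert by (auto simp: hypersum_insert)
  finally show ?case .
qed

section \<open>Hyperfields\<close>

text \<open>Multiplying \<open>0 \<in> x \<boxplus> - x\<close> by \<open>a\<close> shows that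
  \<open>a * - x\<close> is a hyperinverse of \<open>a * x\<close>, and hyperinverses are
  unique.\<close>

lemma hyperfield_mult_minus [simp]: "a * - x = - (a * x)" for a x :: "'f::hyperfield"
proof -
  have "0 \<in> x \<boxplus> (- x)"
    by (simp add: zero_in_hyperadd_iff)
  then have "a * 0 \<in> (\<lambda>w. a * w) ` (x \<boxplus> (- x))"
    by (rule imageI)
  then show ?thesis
    by (simp add: mult_hyperadd zero_in_hyperadd_iff)
qed

lemma hyperfield_minus_mult [simp]: "(- a) * x = - (a * x)" for a x :: "'f::hyperfield"
  using hyperfield_mult_minus[of x a] by (simp add: mult.commute)

lemma hyperfield_mult_eq_0_iff [simp]: "a * x = 0 \<longleftrightarrow> a = 0 \<or> x = 0" for a x :: "'f::hyperfield"
proof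
  assume *: "a * x = 0"
  show "a = 0 \<or> x = 0"
  proof (rule disjCI)
    assume "x \<noteq> 0"
    then obtain b where "x * b = 1"
      using nonzero_invertible by blast
    then have "a = (a * x) * b"
      by (simp add: mult.assoc)
    then show "a = 0"
      using * by simp
  qed
qed auto

lemma support_scale [simp]: "\<alpha> \<noteq> 0 \<Longrightarrow> support (\<alpha> \<odot> X) = support X"
  by (auto simp: support_def scale_def)

lemma scale_apply: "(\<alpha> \<odot> X) e = \<alpha> * X e"
  by (simp add: scale_def)

lemma scale_zero_left: "0 \<odot> X = 0"
  by (simp add: scale_def fun_eq_iff)

lemma scale_minus_left: "(- \<alpha>) \<odot> X = - (\<alpha> \<odot> X)"
  by (simp add: scale_def fun_eq_iff)

lemma support_eq_empty_iff: "support X = {} \<longleftrightarrow> X = 0"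
  by (auto simp: support_def fun_eq_iff)

section \<open>Heights in the lattice of unions of supports\<close>

definition strict_chain :: "'a set set \<Rightarrow> (nat \<Rightarrow> 'a set) \<Rightarrow> nat \<Rightarrow> bool" where
  "strict_chain U c n \<longleftrightarrow> (\<forall>i\<le>n. c i \<in> U) \<and> (\<forall>i<n. c i \<subset> c (Suc i))"

lemma height_eq_Greatest: "height U A = (GREATEST n. \<exists>c. strict_chain U c n \<and> c n = A)"
  by (simp add: height_def strict_chain_def conj_assoc)

lemma strict_chain_mono:
  assumes "strict_chain U c n" "i \<le> j" "j \<le> n"
  shows "c i \<subseteq> c j"
  using assms(2,3)
proof (induction j rule: dec_induct)
  case (step k)
  then have "c k \<subset> c (Suc k)"
    using assms(1) by (simp add: strict_chain_def)
  then show ?case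
    using step by auto
qed simp

text \<open>Bounds the length of all chains with a given top, so that the greatest length in
  \<open>height\<close> exists.\<close>

lemma strict_chain_card:
  fixes c :: "nat \<Rightarrow> 'a::finite set"
  assumes "strict_chain U c n"
  shows "n \<le> card (c n)"
proof -
  have "i \<le> n \<Longrightarrow> i \<le> card (c i)" for i
  proof (induction i)
    case (Suc i)
    then have "card (c i) < card (c (Suc i))"
      using assms by (intro psubset_card_mono) (auto simp: strict_chain_def)
    with Suc show ?case by simp
  qed simp
  then show ?thesis by simp
qed

lemma height_ge:
  fixes A :: "'a::finite set"
  assumes "strict_chain U c n" "c n = A"
  shows "n \<le> height U A"
  unfolding height_eq_Greatest
  by (rule Greatest_le_nat[where b = "card A"]) (use assms strict_chain_card in blast)+

lemma height_eqI:
  fixes A :: "'a::finite set"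
  assumes "strict_chain U c n" "c n = A"
    and "\<And>c m. strict_chain U c m \<Longrightarrow> c m = A \<Longrightarrow> m \<le> n"
  shows "height U A = n"
  unfolding height_eq_Greatest by (rule Greatest_equality) (use assms in blast)+

text \<open>The family with union \<open>A\<close> can be taken to consist of all vectors supported
  inside \<open>A\<close>. This makes membership a condition on single elements.\<close>

lemma support_unions_iff:
  "A \<in> support_unions \<C> \<longleftrightarrow> (\<forall>x\<in>A. \<exists>X\<in>\<C>. x \<in> support X \<and> support X \<subseteq> A)"
proof
  assume "A \<in> support_unions \<C>"
  then show "\<forall>x\<in>A. \<exists>X\<in>\<C>. x \<in> support X \<and> support X \<subseteq> A"
    unfolding support_unions_def by blast
next
  assume *: "\<forall>x\<in>A. \<exists>X\<in>\<C>. x \<in> support X \<and> support X \<subseteq> A"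
  have "A = \<Union>(support ` {X\<in>\<C>. support X \<subseteq> A})"
    using * by blast
  then show "A \<in> support_unions \<C>"
    unfolding support_unions_def by blast
qed

text \<open>Source of all lower bounds on heights: vectors listed so that each support brings a new
  element. The chain starts at the empty union, so \<open>n\<close> vectors give \<open>n\<close>
  steps.\<close>

lemma strict_chain_partial_unions:
  assumes "\<And>i. i < n \<Longrightarrow> X i \<in> \<C>"
    and "\<And>i. i < n \<Longrightarrow> \<not> support (X i) \<subseteq> (\<Union>j<i. support (X j))"
  shows "strict_chain (support_unions \<C>) (\<lambda>i. \<Union>j<i. support (X j)) n"
  unfolding strict_chain_def
proof (intro conjI allI impI)
  fix i assume "i \<le> n"
  show "(\<Union>j<i. support (X j)) \<in> support_unions \<C>"
    unfolding support_unions_iff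
  proof
    fix x assume "x \<in> (\<Union>j<i. support (X j))"
    then obtain j where "j < i" "x \<in> support (X j)"
      by blast
    moreover from this have "support (X j) \<subseteq> (\<Union>j<i. support (X j))"
      by blast
    ultimately show "\<exists>V\<in>\<C>. x \<in> support V \<and> support V \<subseteq> (\<Union>j<i. support (X j))"
      using assms(1)[of j] \<open>i \<le> n\<close> by auto
  qed
next
  fix i assume "i < n"
  have "(\<Union>j<Suc i. support (X j)) = support (X i) \<union> (\<Union>j<i. support (X j))"
    by (simp add: lessThan_Suc)
  then show "(\<Union>j<i. support (X j)) \<subset> (\<Union>j<Suc i. support (X j))"
    using assms(2)[OF \<open>i < n\<close>] by blast
qed

section \<open>Matroids\<close>

context matroid
begin

lemma finite_indep: "indep I \<Longrightarrow> finite I"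
  using finite_ground indep_subset_ground finite_subset by blast

text \<open>Augmentation from \<open>J\<close> is repeated until the deficit
  \<open>card J - card I\<close> is used up.\<close>

lemma indep_extend:
  assumes "indep I" "indep J"
  shows "\<exists>K. I \<subseteq> K \<and> K \<subseteq> I \<union> J \<and> indep K \<and> card J \<le> card K"
  using assms(1)
proof (induction "card J - card I" arbitrary: I rule: less_induct)
  case less
  show ?case
  proof (cases "card I < card J")
    case True
    then obtain x where x: "x \<in> J - I" "indep (insert x I)"
      using indep_augment less.prems assms(2) by blast
    have "card (insert x I) = Suc (card I)"
      using x(1) finite_indep[OF less.prems] by simp
    then have "card J - card (insert x I) < card J - card I"
      using True by simp
    from less.hyps[OF this x(2)] show ?thesis
      using x(1) by blast
  next
    case False
    then show ?thesis
      using less.prems by (intro exI[of _ I]) auto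
  qed
qed

lemma dependent_contains_circuit:
  assumes "D \<subseteq> ground" "\<not> indep D"
  obtains C where "circuit C" "C \<subseteq> D"
proof -
  have "finite D"
    using assms(1) finite_ground finite_subset by blast
  then have "\<exists>C. circuit C \<and> C \<subseteq> D"
    using assms
  proof (induction D rule: finite_psubset_induct)
    case (psubset D)
    show ?case
    proof (cases "\<forall>D'. D' \<subset> D \<longrightarrow> indep D'")
      case True
      then show ?thesis
        using psubset.prems unfolding circuit_def by blast
    next
      case False
      then obtain D' where "D' \<subset> D" "\<not> indep D'"
        by blast
      then show ?thesis
        using psubset.IH[of D'] psubset.prems by blast
    qed
  qed
  then show ?thesis
    using that by blast
qed

lemma indep_no_circuit: "indep I \<Longrightarrow> circuit C \<Longrightarrow> \<not> C \<subseteq> I"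
  using indep_mono[of I C] by (auto simp: circuit_def)

lemma indep_extends_to_basis:
  assumes "indep I"
  obtains B where "basis B" "I \<subseteq> B"
proof -
  let ?S = "{J. indep J \<and> I \<subseteq> J}"
  have fin: "finite ?S"
    using finite_ground indep_subset_ground by (auto intro: finite_subset[of _ "Pow ground"])
  have "I \<in> ?S"
    using assms by simp
  from finite_has_maximal2[OF fin this] obtain B
    where "B \<in> ?S" and maximal: "\<forall>J\<in>?S. B \<subseteq> J \<longrightarrow> B = J"
    by blast
  then have B: "indep B" "I \<subseteq> B"
    by simp_all
  have "J = B" if "indep J" "B \<subseteq> J" for J
  proof -
    have "J \<in> ?S"
      using that B(2) by blast
    then show ?thesis
      using maximal that(2) by blast
  qed
  then have "basis B"
    using B(1) by (simp add: basis_def)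
  then show ?thesis
    using that B(2) by blast
qed

text \<open>For \<open>f\<close> in \<open>C\<close> but not in \<open>D\<close>, extend the
  independent set \<open>C - {f}\<close> by elements of \<open>B\<close> to the size of
  \<open>B\<close>. The result cannot contain \<open>f\<close>, so it is all of
  \<open>insert e B - {f}\<close> and contains the circuit \<open>D\<close>.\<close>

lemma circuit_in_insert_basis_unique:
  assumes "basis B" "circuit C" "circuit D" "C \<subseteq> insert e B" "D \<subseteq> insert e B"
  shows "C = D"
proof (rule ccontr)
  assume "C \<noteq> D"
  have "indep B"
    using assms(1) by (simp add: basis_def)
  have "\<not> C \<subseteq> D"
    using \<open>C \<noteq> D\<close> assms(2,3) unfolding circuit_def by blast
  then obtain f where f: "f \<in> C" "f \<notin> D"
    by blast
  have "e \<in> D"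
    using indep_no_circuit[OF \<open>indep B\<close> assms(3)] assms(5) by blast
  have "e \<notin> B"
    using indep_no_circuit[OF \<open>indep B\<close> assms(3)] assms(5) by (auto simp: insert_absorb)
  have "indep (C - {f})"
    using assms(2) f unfolding circuit_def by blast
  from indep_extend[OF this \<open>indep B\<close>] obtain K where
    K: "C - {f} \<subseteq> K" "K \<subseteq> C - {f} \<union> B" "indep K" "card B \<le> card K"
    by blast
  have "f \<notin> K"
    using K(1) indep_no_circuit[OF K(3) assms(2)] by blast
  moreover have "f \<in> insert e B"
    using f assms(4) by blast
  moreover have "K \<subseteq> insert e B"
    using K(2) assms(4) by blast
  ultimately have "K \<subseteq> insert e B - {f}"
    by blast
  moreover have "card (insert e B - {f}) = card B"
    using \<open>f \<in> insert e B\<close> \<open>e \<notin> B\<close> finite_indep[OF \<open>indep B\<close>] by (simp add: card_Diff_singleton)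
  ultimately have "K = insert e B - {f}"
    using K(4) finite_indep[OF \<open>indep B\<close>] by (intro card_seteq) auto
  then have "D \<subseteq> K"
    using assms(5) f(2) by blast
  then show False
    using indep_no_circuit[OF K(3) assms(3)] by blast
qed

lemma fundamental_circuit_eqI:
  "basis B \<Longrightarrow> circuit C \<Longrightarrow> C \<subseteq> insert e B \<Longrightarrow> fundamental_circuit B e = C"
  unfolding fundamental_circuit_def by (rule the_equality) (use circuit_in_insert_basis_unique in blast)+

lemma fundamental_circuit:
  assumes "basis B" "e \<in> ground - B"
  shows "circuit (fundamental_circuit B e)" "fundamental_circuit B e \<subseteq> insert e B"
    "e \<in> fundamental_circuit B e"
proof -
  have "indep B" "\<not> indep (insert e B)"
    using assms unfolding basis_def by blast+
  moreover have "insert e B \<subseteq> ground"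
    using \<open>indep B\<close> assms(2) indep_subset_ground by blast
  ultimately obtain C where C: "circuit C" "C \<subseteq> insert e B"
    using dependent_contains_circuit by blast
  have eq: "fundamental_circuit B e = C"
    using fundamental_circuit_eqI assms(1) C by blast
  show "circuit (fundamental_circuit B e)" "fundamental_circuit B e \<subseteq> insert e B"
    using C eq by auto
  then show "e \<in> fundamental_circuit B e"
    using indep_no_circuit[OF \<open>indep B\<close>] by blast
qed

text \<open>Nullity is cardinality minus rank; a lower bound \<open>m\<close> for it is written
  without subtraction, as a bound on every independent subset. Adding a circuit that leaves
  \<open>S\<close> at \<open>x\<close> raises the bound by one: \<open>J\<close> may be replaced by
  an independent \<open>K\<close> at least as large that contains \<open>C - {x}\<close>, hence
  misses \<open>x\<close> and has fewer than \<open>card (T - S)\<close> elements outside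
  \<open>S\<close>.\<close>

lemma nullity_step:
  assumes "finite T" "S \<subseteq> T" "circuit C" "C \<subseteq> T" "\<not> C \<subseteq> S"
    and bound: "\<And>J. indep J \<Longrightarrow> J \<subseteq> S \<Longrightarrow> card J + m \<le> card S"
    and "indep J" "J \<subseteq> T"
  shows "card J + Suc m \<le> card T"
proof -
  obtain x where x: "x \<in> C" "x \<notin> S"
    using assms(5) by blast
  have "indep (C - {x})"
    using assms(3) x unfolding circuit_def by blast
  from indep_extend[OF this \<open>indep J\<close>] obtain K where
    K: "C - {x} \<subseteq> K" "K \<subseteq> C - {x} \<union> J" "indep K" "card J \<le> card K"
    by blast
  have "x \<notin> K"
    using K(1) indep_no_circuit[OF K(3) assms(3)] by blast
  have fin: "finite S" "finite K"
    using finite_subset[OF assms(2,1)] finite_indep[OF K(3)] by simp_all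
  have "K \<subseteq> T"
    using K(2) assms(4,8) by blast
  then have "K - S \<subseteq> T - S - {x}"
    using \<open>x \<notin> K\<close> by blast
  then have "card (K - S) \<le> card (T - S - {x})"
    using assms(1) by (intro card_mono) auto
  moreover have "Suc (card (T - S - {x})) = card (T - S)"
    using assms(1,4) x by (intro card_Suc_Diff1) blast+
  moreover have "card (T - S) + card S = card T"
    using card_Diff_subset[OF fin(1) assms(2)] card_mono[OF assms(1,2)] by simp
  moreover have "card (K \<inter> S) + m \<le> card S"
    using bound[OF indep_mono[OF K(3)]] by simp
  moreover have "card K = card (K \<inter> S) + card (K - S)"
    by (rule card_Int_Diff[OF fin(2)])
  ultimately show ?thesis
    using K(4) by linarith
qed

end

text \<open>The augmentation argument: among the independent subsets of \<open>I \<union> J\<close> larger than \<open>I\<close>, one that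
  misses as little of \<open>I\<close> as possible contains \<open>I\<close>.\<close>

lemma matroid_of_circuits:
  fixes \<D> :: "'e::finite set set"
  assumes nonempty: "{} \<notin> \<D>"
    and elim: "\<And>C D e. C \<in> \<D> \<Longrightarrow> D \<in> \<D> \<Longrightarrow> C \<noteq> D \<Longrightarrow> e \<in> C \<inter> D \<Longrightarrow> \<exists>Z\<in>\<D>. Z \<subseteq> (C \<union> D) - {e}"
  shows "matroid UNIV (\<lambda>I. \<forall>D\<in>\<D>. \<not> D \<subseteq> I)"
proof
  fix I J :: "'e set"
  let ?indep = "\<lambda>I. \<forall>D\<in>\<D>. \<not> D \<subseteq> I"
  assume I: "?indep I" and J: "?indep J" and card: "card I < card J"
  let ?P = "\<lambda>K. ?indep K \<and> K \<subseteq> I \<union> J \<and> card I < card K"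
  obtain K where K: "?P K" and min: "\<And>L. ?P L \<Longrightarrow> card (I - K) \<le> card (I - L)"
    using ex_has_least_nat[of ?P J "\<lambda>K. card (I - K)"] J card by auto
  have "\<not> K \<subseteq> I"
    using K card_mono[of I K] by auto
  have "I \<subseteq> K"
  proof (rule ccontr)
    assume "\<not> I \<subseteq> K"
    then obtain e where e: "e \<in> I" "e \<notin> K"
      by blast
    \<comment> \<open>Replacing \<open>f\<close> by \<open>e\<close> keeps the size but misses less
      of \<open>I\<close>. By minimality the new set is dependent, and since \<open>K\<close> is
      not, the offending member of \<open>\<D>\<close> passes through \<open>e\<close>.\<close>
    have exchange: "\<exists>D\<in>\<D>. D \<subseteq> insert e K - {f} \<and> e \<in> D" if f: "f \<in> K" "f \<notin> I" for f
    proof -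
      let ?L = "insert e K - {f}"
      have "I - ?L \<subset> I - K"
        using e f by blast
      then have "card (I - ?L) < card (I - K)"
        by (intro psubset_card_mono) auto
      then have "\<not> ?P ?L"
        using min[of ?L] by linarith
      moreover have "card ?L = card K"
        using e f by (simp add: card_Diff_singleton)
      ultimately obtain D where "D \<in> \<D>" "D \<subseteq> ?L"
        using K e by auto
      moreover from this have "e \<in> D"
        using K by blast
      ultimately show ?thesis
        by blast
    qed
    obtain g where g: "g \<in> K" "g \<notin> I"
      using \<open>\<not> K \<subseteq> I\<close> by blast
    obtain C where C: "C \<in> \<D>" "C \<subseteq> insert e K - {g}" "e \<in> C"
      using exchange g by blast
    \<comment> \<open>A second exchange, at \<open>h\<close>, yields a \<open>D\<close> avoiding
      \<open>h\<close>. It differs from \<open>C\<close>, and eliminating \<open>e\<close> from the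
      two leaves a member of \<open>\<D>\<close> inside \<open>K\<close>.\<close>
    obtain h where h: "h \<in> C" "h \<notin> I"
      using I C(1) by blast
    have "h \<in> K"
      using C(2) h e by blast
    then obtain D where D: "D \<in> \<D>" "D \<subseteq> insert e K - {h}" "e \<in> D"
      using exchange h by blast
    obtain Z where "Z \<in> \<D>" "Z \<subseteq> (C \<union> D) - {e}"
      using elim[of C D e] C D h by blast
    then show False
      using K C(2) D(2) by blast
  qed
  then obtain x where "x \<in> K - I"
    using \<open>\<not> K \<subseteq> I\<close> by blast
  then have "x \<in> J - I" "?indep (insert x I)"
    using K \<open>I \<subseteq> K\<close> by blast+
  then show "\<exists>x\<in>J - I. ?indep (insert x I)"
    by blast
qed (use nonempty in auto)

lemma circuit_of_circuits:
  fixes \<D> :: "'e::finite set set"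
  assumes "matroid UNIV (\<lambda>I. \<forall>D\<in>\<D>. \<not> D \<subseteq> I)"
    and antichain: "\<And>C D. C \<in> \<D> \<Longrightarrow> D \<in> \<D> \<Longrightarrow> C \<subseteq> D \<Longrightarrow> C = D"
  shows "{C. matroid.circuit UNIV (\<lambda>I. \<forall>D\<in>\<D>. \<not> D \<subseteq> I) C} = \<D>"
  unfolding matroid.circuit_def[OF assms(1)] using antichain by blast

section \<open>Vectors supported on circuits\<close>

locale circuit_vectors =
  fixes \<C> :: "('e::finite \<Rightarrow> 'f::hyperfield) set"
  assumes zero_notin: "0 \<notin> \<C>"
    and scale_in: "\<And>X \<alpha>. X \<in> \<C> \<Longrightarrow> \<alpha> \<noteq> 0 \<Longrightarrow> \<alpha> \<odot> X \<in> \<C>"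
    and support_le: "\<And>X Y. X \<in> \<C> \<Longrightarrow> Y \<in> \<C> \<Longrightarrow> support X \<subseteq> support Y \<Longrightarrow> \<exists>\<alpha>. \<alpha> \<noteq> 0 \<and> X = \<alpha> \<odot> Y"
begin

lemma support_antichain:
  "X \<in> \<C> \<Longrightarrow> Y \<in> \<C> \<Longrightarrow> support X \<subseteq> support Y \<Longrightarrow> support X = support Y"
  using support_le support_scale by metis

lemma support_nonempty: "X \<in> \<C> \<Longrightarrow> support X \<noteq> {}"
  using zero_notin support_eq_empty_iff by metis

text \<open>In a chain with at least three steps, \<open>c 1\<close> is nonempty and contains a
  support, and \<open>c 2\<close> contains another one reaching outside \<open>c 1\<close>. Both lie
  in \<open>c 2\<close>, a proper subset of the top.\<close>

lemma modular_pair_or_smaller: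
  assumes "X \<in> \<C>" "Y \<in> \<C>" "support X \<noteq> support Y"
  shows "height (support_unions \<C>) (support X \<union> support Y) = 2 \<or>
    (\<exists>V\<in>\<C>. \<exists>W\<in>\<C>. support V \<noteq> support W \<and> support V \<union> support W \<subset> support X \<union> support Y)"
proof (rule disjCI)
  assume no: "\<not> (\<exists>V\<in>\<C>. \<exists>W\<in>\<C>. support V \<noteq> support W
    \<and> support V \<union> support W \<subset> support X \<union> support Y)"
  let ?X = "\<lambda>i::nat. if i = 0 then X else Y"
  have nsub: "\<not> support Y \<subseteq> support X"
    using assms support_antichain by metis
  have chain: "strict_chain (support_unions \<C>) (\<lambda>i. \<Union>j<i. support (?X j)) 2"
    by (rule strict_chain_partial_unions)
      (use assms nsub support_nonempty in \<open>auto simp: less_2_cases_iff\<close>)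
  have top: "(\<Union>j<2. support (?X j)) = support X \<union> support Y"
    by (auto simp: numeral_2_eq_2 lessThan_Suc)
  show "height (support_unions \<C>) (support X \<union> support Y) = 2"
  proof (rule height_eqI[OF chain top])
    fix c m
    assume c: "strict_chain (support_unions \<C>) c m" "c m = support X \<union> support Y"
    show "m \<le> 2"
    proof (rule ccontr)
      assume "\<not> m \<le> 2"
      then have m: "3 \<le> m"
        by simp
      have step: "c i \<subset> c (Suc i)" if "i < m" for i
        using c(1) that by (simp add: strict_chain_def)
      have U: "c i \<in> support_unions \<C>" if "i \<le> m" for i
        using c(1) that by (simp add: strict_chain_def)
      have c01: "c 0 \<subset> c 1" and c12: "c 1 \<subset> c 2" and c23: "c 2 \<subset> c 3"
        using step[of 0] step[of 1] step[of 2] m by (simp_all add: numeral_2_eq_2 numeral_3_eq_3)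
      obtain V where V: "V \<in> \<C>" "support V \<subseteq> c 1"
        using c01 U[of 1] m unfolding support_unions_iff by (meson le_trans one_le_numeral psubset_imp_ex_mem DiffE)
      obtain x where "x \<in> c 2" "x \<notin> c 1"
        using c12 by blast
      then obtain W where W: "W \<in> \<C>" "support W \<subseteq> c 2" "x \<in> support W"
        using U[of 2] m unfolding support_unions_iff by auto
      have "support V \<noteq> support W"
        using V W \<open>x \<notin> c 1\<close> by blast
      moreover have "support V \<union> support W \<subset> support X \<union> support Y"
        using V(2) W(2) c12 c23 strict_chain_mono[OF c(1) m order_refl] c(2) by blast
      ultimately show False
        using no V(1) W(1) by blast
    qed
  qed
qed

lemma modular_pair_elimination:
  assumes SME: "strong_modular_elimination \<C>"
    and X: "X \<in> \<C>" and Y: "Y \<in> \<C>" and ne: "support X \<noteq> support Y"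
    and e: "e \<in> support X \<inter> support Y"
    and height: "height (support_unions \<C>) (support X \<union> support Y) = 2"
  shows "\<exists>Z\<in>\<C>. support Z \<subseteq> (support X \<union> support Y) - {e}"
proof -
  obtain b where b: "Y e * b = 1"
    using e nonzero_invertible[of "Y e"] by (auto simp: support_def)
  \<comment> \<open>Elimination wants opposite entries at \<open>e\<close>; since \<open>b\<close>
    inverts \<open>Y e\<close>, this factor rescales \<open>Y\<close> to have the entry
    \<open>- X e\<close> there.\<close>
  define \<alpha> where "\<alpha> = - (X e * b)"
  have \<alpha>: "\<alpha> * Y e = - X e"
    unfolding \<alpha>_def using b by (simp add: mult.assoc mult.commute[of b])
  have "X e \<noteq> 0"
    using e by (simp add: support_def)
  then have "\<alpha> \<noteq> 0"
    using \<alpha> by auto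
  let ?X = "\<lambda>i::nat. if i = 0 then X else \<alpha> \<odot> Y"
  have two: "{0..Suc 0} = {0, Suc 0}"
    by auto
  have "modular_family \<C> ?X {0..1}"
    using X Y scale_in \<open>\<alpha> \<noteq> 0\<close> height by (simp add: modular_family_def two)
  moreover have "\<not> support (?X 0) \<subseteq> (\<Union>i\<in>{1..1}. support (?X i))"
    using X Y ne \<open>\<alpha> \<noteq> 0\<close> support_antichain by auto
  moreover have "\<forall>i\<in>{1..1}. e \<in> (support (?X 0) \<inter> support (?X i)) - (\<Union>j\<in>{1..1} - {i}. support (?X j))
      \<and> ?X 0 e = - ?X i e \<and> - ?X i e \<noteq> 0"
    using e \<open>\<alpha> \<noteq> 0\<close> \<alpha> \<open>X e \<noteq> 0\<close> by (simp add: scale_apply)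
  ultimately obtain Z where Z: "Z \<in> \<C>" "Z e = 0" "\<And>f. Z f \<in> hypersum (\<lambda>i. ?X i f) {0..1}"
    using SME[unfolded strong_modular_elimination_def, rule_format, of ?X 1 "\<lambda>_. e"] by auto
  have "support Z \<subseteq> support X \<union> support Y"
  proof
    fix f assume "f \<in> support Z"
    show "f \<in> support X \<union> support Y"
    proof (rule ccontr)
      assume "f \<notin> support X \<union> support Y"
      then have "hypersum (\<lambda>i. ?X i f) {0..1} = {0}"
        by (intro hypersum_zero) (auto simp: support_def scale_apply)
      then show False
        using Z(3)[of f] \<open>f \<in> support Z\<close> by (simp add: support_def)
    qed
  qed
  then show ?thesis
    using Z(1,2) by (intro bexI[of _ Z]) (auto simp: support_def)
qed

lemma circuit_elimination:
  assumes SME: "strong_modular_elimination \<C>"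
    and "X \<in> \<C>" "Y \<in> \<C>" "support X \<noteq> support Y" "e \<in> support X \<inter> support Y"
  shows "\<exists>Z\<in>\<C>. support Z \<subseteq> (support X \<union> support Y) - {e}"
  using assms(2-)
proof (induction "card (support X \<union> support Y)" arbitrary: X Y rule: less_induct)
  case less
  consider "height (support_unions \<C>) (support X \<union> support Y) = 2"
    | V W where "V \<in> \<C>" "W \<in> \<C>" "support V \<noteq> support W"
      "support V \<union> support W \<subset> support X \<union> support Y"
    using modular_pair_or_smaller[OF less.prems(1-3)] by blast
  then show ?case
  proof cases
    case 1
    show ?thesis
      by (rule modular_pair_elimination[OF SME less.prems 1])
  next
    case 2
    have "card (support V \<union> support W) < card (support X \<union> support Y)"
      using 2(4) by (intro psubset_card_mono) auto
    note IH = less.hyps[OF this 2(1-3)]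
    show ?thesis
    proof (cases "e \<in> support V \<inter> support W")
      case True
      from IH[OF this] obtain Z where Z: "Z \<in> \<C>" "support Z \<subseteq> (support V \<union> support W) - {e}"
        by (rule bexE)
      have "support Z \<subseteq> (support X \<union> support Y) - {e}"
        using Z(2) 2(4) by blast
      with Z(1) show ?thesis
        by blast
    next
      case False
      \<comment> \<open>One of the two smaller circuits already avoids \<open>e\<close> and needs no
        elimination.\<close>
      then obtain Z where Z: "Z \<in> {V, W}" "e \<notin> support Z"
        by blast
      have "support Z \<subseteq> (support X \<union> support Y) - {e}"
        using Z 2(4) by blast
      moreover have "Z \<in> \<C>"
        using Z(1) 2(1,2) by blast
      ultimately show ?thesis
        by (rule bexI)
    qed
  qed
qed

end

section \<open>Fundamental vectors, and heights as nullities\<close>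

locale circuit_vectors_of_matroid = circuit_vectors \<C> + matroid UNIV indep
  for \<C> :: "('e::finite \<Rightarrow> 'f::hyperfield) set" and indep :: "'e set \<Rightarrow> bool" +
  assumes supports: "support ` \<C> = {C. circuit C}"
begin

lemma circuit_support: "X \<in> \<C> \<Longrightarrow> circuit (support X)"
  using supports[THEN equalityD1] by (simp add: image_subset_iff)

lemma circuit_is_support: "circuit C \<Longrightarrow> \<exists>X\<in>\<C>. support X = C"
  using supports[THEN equalityD2, THEN subsetD, of C] by auto

abbreviation fv :: "'e set \<Rightarrow> 'e \<Rightarrow> 'e \<Rightarrow> 'f" where
  "fv \<equiv> fundamental_vector indep \<C>"

text \<open>Shows that the definite description is proper. Rescaling a vector on the fundamental
  circuit gives existence; two candidates differ by a factor, which their entries \<open>1\<close>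
  at \<open>e\<close> force to be \<open>1\<close>.\<close>

lemma fundamental_vector:
  assumes "basis B" "e \<notin> B"
  shows "fv B e \<in> \<C>" "fv B e e = 1" "support (fv B e) = fundamental_circuit B e"
proof -
  have fc: "circuit (fundamental_circuit B e)" "e \<in> fundamental_circuit B e"
    using fundamental_circuit assms by auto
  obtain Y where Y: "Y \<in> \<C>" "support Y = fundamental_circuit B e"
    using circuit_is_support fc(1) by blast
  have "Y e \<noteq> 0"
    using fc(2) Y(2) by (auto simp: support_def)
  then obtain b where b: "Y e * b = 1"
    using nonzero_invertible by blast
  have "b \<noteq> 0"
    using b by auto
  let ?P = "\<lambda>Y. Y \<in> \<C> \<and> Y e = 1 \<and> support Y = fundamental_circuit B e"
  have "?P (b \<odot> Y)"
    using Y b \<open>b \<noteq> 0\<close> scale_in by (simp add: scale_apply mult.commute)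
  moreover have "V = b \<odot> Y" if V: "?P V" for V
  proof -
    let ?W = "b \<odot> Y"
    have W: "?P ?W"
      by (rule calculation)
    obtain \<alpha> where \<alpha>: "V = \<alpha> \<odot> ?W"
      using support_le[of V ?W] V W by auto
    have "\<alpha> * ?W e = V e"
      using fun_cong[OF \<alpha>, of e] by (simp add: scale_apply)
    moreover have "?W e = 1" "V e = 1"
      using V W by simp_all
    ultimately have "\<alpha> = 1"
      by (simp only: mult_1_right)
    then show ?thesis
      using \<alpha> by (simp add: scale_def)
  qed
  ultimately have "?P (fv B e)"
    unfolding fundamental_vector_def by (rule theI[of ?P])
  then show "fv B e \<in> \<C>" "fv B e e = 1" "support (fv B e) = fundamental_circuit B e"
    by simp_all
qed

lemma fundamental_vector_eq_0:
  assumes "basis B" "e \<notin> B" "f \<notin> B" "f \<noteq> e"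
  shows "fv B e f = 0"
  using fundamental_vector(3)[of B e] fundamental_circuit(2)[of B e] assms
  by (auto simp: support_def)

lemma eq_scaled_fundamental_vector:
  assumes "basis B" "e \<notin> B" "X \<in> \<C>" "support X \<subseteq> insert e B"
  shows "X = X e \<odot> fv B e"
proof -
  have "fundamental_circuit B e = support X"
    by (rule fundamental_circuit_eqI[OF assms(1) circuit_support[OF assms(3)] assms(4)])
  then obtain \<alpha> where \<alpha>: "X = \<alpha> \<odot> fv B e"
    using support_le[of X "fv B e"] fundamental_vector[of B e] assms by auto
  then have "X e = \<alpha>"
    using fundamental_vector(2)[of B e] assms fun_cong[OF \<alpha>, of e] by (simp add: scale_apply)
  then show ?thesis
    using \<alpha> by simp
qed

text \<open>Every step of a chain of unions brings in a circuit not contained in the previous member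
  and so raises the nullity. The nullity of the top thus bounds the number of steps.\<close>

lemma strict_chain_nullity:
  assumes "strict_chain (support_unions \<C>) c n" "indep J" "J \<subseteq> c n"
  shows "card J + n \<le> card (c n)"
proof -
  have "indep J \<Longrightarrow> J \<subseteq> c i \<Longrightarrow> card J + i \<le> card (c i)" if "i \<le> n" for i J
    using that
  proof (induction i arbitrary: J)
    case 0
    then show ?case
      by (simp add: card_mono)
  next
    case (Suc i)
    have "c i \<subset> c (Suc i)" "c (Suc i) \<in> support_unions \<C>"
      using assms(1) Suc.prems by (auto simp: strict_chain_def)
    then obtain X where "X \<in> \<C>" "support X \<subseteq> c (Suc i)" "\<not> support X \<subseteq> c i"
      unfolding support_unions_iff by blast
    then show ?case
      using nullity_step[of "c (Suc i)" "c i" "support X" i J] \<open>c i \<subset> c (Suc i)\<close> Suc circuit_support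
      by auto
  qed
  then show ?thesis
    using assms by blast
qed

text \<open>The set \<open>A\<close> of the elimination family is a disjoint union of a subset of the basis \<open>B\<close> and
  \<open>{e 0, \<dots>, e k}\<close>, so its nullity, which bounds the length of every chain below it, is \<open>k + 1\<close>.\<close>

lemma height_elimination_family:
  assumes "basis B" "bij_betw e {0..k} (A - B)"
    and A: "A = (\<Union>i\<in>{0..k}. support (X i))"
    and X: "\<And>i. i \<le> k \<Longrightarrow> X i \<in> \<C>" and e: "\<And>i. i \<le> k \<Longrightarrow> e i \<in> support (X i)"
    and supp: "\<And>i. 1 \<le> i \<Longrightarrow> i \<le> k \<Longrightarrow> support (X i) \<subseteq> insert (e i) B"
  shows "height (support_unions \<C>) A = Suc k"
proof -
  \<comment> \<open>The order is \<open>X 1, \<dots>, X k, X 0\<close>. The support of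
    \<open>X 0\<close> may contain every \<open>e i\<close>, so it comes last, where it still brings
    the new element \<open>e 0\<close>.\<close>
  let ?Y = "\<lambda>i. X (if i = k then 0 else Suc i)"
  have inj: "e i \<noteq> e j" if "i \<le> k" "j \<le> k" "i \<noteq> j" for i j
    using bij_betw_imp_inj_on[OF assms(2)] that by (simp add: inj_on_eq_iff)
  have enB: "e i \<notin> B" if "i \<le> k" for i
    using bij_betwE[OF assms(2)] that by simp
  have notin: "e i \<notin> support (X j)" if "i \<le> k" "1 \<le> j" "j \<le> k" "i \<noteq> j" for i j
    using subsetD[OF supp[OF that(2,3)]] inj[OF that(1,3,4)] enB[OF that(1)] by auto
  have chain: "strict_chain (support_unions \<C>) (\<lambda>i. \<Union>j<i. support (?Y j)) (Suc k)"
  proof (rule strict_chain_partial_unions)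
    fix i assume i: "i < Suc k"
    then show "?Y i \<in> \<C>"
      using X by simp
    let ?i = "if i = k then 0 else Suc i"
    have "e ?i \<in> support (?Y i)"
      using e i by simp
    moreover have "e ?i \<notin> support (?Y j)" if "j < i" for j
      using notin[of ?i "Suc j"] i that by auto
    ultimately show "\<not> support (?Y i) \<subseteq> (\<Union>j<i. support (?Y j))"
      by blast
  qed
  have top: "(\<Union>j<Suc k. support (?Y j)) = A"
  proof (intro equalityI UN_least)
    show "support (?Y j) \<subseteq> A" if "j \<in> {..<Suc k}" for j
    proof -
      have "(if j = k then 0 else Suc j) \<in> {0..k}"
        using that by simp
      then show ?thesis
        unfolding A by (rule UN_upper)
    qed
    have "support (X j) \<subseteq> (\<Union>j<Suc k. support (?Y j))" if "j \<in> {0..k}" for j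
    proof -
      let ?j = "if j = 0 then k else j - 1"
      have "?Y ?j = X j" "?j \<in> {..<Suc k}"
        using that by auto
      then show ?thesis
        using UN_upper[of ?j "{..<Suc k}" "\<lambda>j. support (?Y j)"] by simp
    qed
    then show "A \<subseteq> (\<Union>j<Suc k. support (?Y j))"
      unfolding A by (rule UN_least)
  qed
  show ?thesis
  proof (rule height_eqI[OF chain top])
    fix c m assume c: "strict_chain (support_unions \<C>) c m" "c m = A"
    have "indep (A \<inter> B)"
      using assms(1) indep_mono[of B] by (simp add: basis_def)
    then have "card (A \<inter> B) + m \<le> card A"
      using strict_chain_nullity[OF c(1)] c(2) by simp
    moreover have "card A = card (A \<inter> B) + card (A - B)"
      by (simp add: card_Int_Diff)
    moreover have "card (A - B) = Suc k"
      using bij_betw_same_card[OF assms(2)] by simp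
    ultimately show "m \<le> Suc k"
      by simp
  qed
qed

section \<open>From strong modular elimination to expansions in fundamental vectors\<close>

lemma in_span_of_fundamental_vectors:
  assumes SME: "strong_modular_elimination \<C>" and X: "X \<in> \<C>" and B: "basis B"
  shows "X \<in> linear_span (fv B) (UNIV - B)"
proof -
  have "indep B"
    using B by (simp add: basis_def)
  define D where "D = support X - B"
  have "D \<noteq> {}"
    unfolding D_def using indep_no_circuit[OF \<open>indep B\<close>] circuit_support X by blast
  then have cardD: "card D \<noteq> 0"
    by simp
  then obtain k where k: "card D = Suc k"
    using not0_implies_Suc by blast
  obtain e where "bij_betw e {0..<card D} D"
    using ex_bij_betw_nat_finite[of D] by auto
  then have e: "bij_betw e {0..k} D"
    by (simp add: k atLeastLessThanSuc_atLeastAtMost)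
  have eD: "e i \<in> D" if "i \<le> k" for i
    using bij_betwE[OF e] that by simp
  have enB: "e i \<notin> B" and eX: "X (e i) \<noteq> 0" if "i \<le> k" for i
    using eD[OF that] by (auto simp: D_def support_def)
  have inj: "e i \<noteq> e j" if "i \<le> k" "j \<le> k" "i \<noteq> j" for i j
    using bij_betw_imp_inj_on[OF e] that by (simp add: inj_on_eq_iff)
  define Y where "Y i = X (e i) \<odot> fv B (e i)" for i
  define V where "V i = (if i = 0 then X else - Y i)" for i
  have V0: "V 0 = X"
    by (simp add: V_def)
  have VS: "V i = (- X (e i)) \<odot> fv B (e i)" if "1 \<le> i" for i
    using that by (auto simp: V_def Y_def scale_minus_left)
  have V_in: "V i \<in> \<C>" if "i \<le> k" for i
    using that X scale_in fundamental_vector(1)[OF B enB] eX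
    by (cases "i = 0") (auto simp: V0 VS)
  have V_e: "V i (e i) = - X (e i)" if "1 \<le> i" "i \<le> k" for i
    using that fundamental_vector(2)[OF B enB] by (simp add: VS scale_apply)
  have V_supp: "support (V i) \<subseteq> insert (e i) B" if "1 \<le> i" "i \<le> k" for i
    using that fundamental_vector(3)[OF B enB] fundamental_circuit(2)[OF B] enB eX by (simp add: VS)
  have notin: "e i \<notin> support (V j)" if "i \<le> k" "1 \<le> j" "j \<le> k" "i \<noteq> j" for i j
    using subsetD[OF V_supp[OF that(2,3)]] inj[OF that(1,3,4)] enB[OF that(1)] by auto
  define A where "A = (\<Union>i\<in>{0..k}. support (V i))"
  have "A - B = D"
  proof
    show "D \<subseteq> A - B"
      by (force simp: A_def D_def V0)
    show "A - B \<subseteq> D"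
    proof
      fix x assume "x \<in> A - B"
      then obtain i where "i \<le> k" "x \<in> support (V i)" "x \<notin> B"
        by (auto simp: A_def)
      then show "x \<in> D"
        using V_supp[of i] eD[of i] by (cases "i = 0") (auto simp: V0 D_def)
    qed
  qed
  have "height (support_unions \<C>) A = Suc k"
  proof (rule height_elimination_family[OF B _ A_def])
    show "bij_betw e {0..k} (A - B)"
      using e \<open>A - B = D\<close> by simp
    show "e i \<in> support (V i)" if "i \<le> k" for i
      using that eX V_e[of i] by (cases "i = 0") (auto simp: V0 support_def)
  qed (use V_in V_supp in auto)
  then have "modular_family \<C> V {0..k}"
    using V_in by (auto simp: modular_family_def A_def)
  moreover have "\<not> support (V 0) \<subseteq> (\<Union>i\<in>{1..k}. support (V i))"
    using eD[of 0] notin[of 0] by (auto simp: V0 D_def)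
  moreover have "\<forall>i\<in>{1..k}. e i \<in> (support (V 0) \<inter> support (V i)) - (\<Union>j\<in>{1..k} - {i}. support (V j))
           \<and> V 0 (e i) = - V i (e i) \<and> - V i (e i) \<noteq> 0"
    using notin eX V_e by (auto simp: V0 support_def)
  ultimately obtain Z where Z: "Z \<in> \<C>" "\<And>i. i \<in> {1..k} \<Longrightarrow> Z (e i) = 0"
      "\<And>f. Z f \<in> hypersum (\<lambda>i. V i f) {0..k}"
    using SME[unfolded strong_modular_elimination_def, rule_format, of V k e] by blast
  \<comment> \<open>Outside \<open>B\<close> the vectors \<open>V i\<close> vanish except on
    \<open>D\<close>, and there \<open>Z\<close> is zero at
    \<open>e 1, \<dots>, e k\<close>.\<close>
  have "support Z \<subseteq> insert (e 0) B"
  proof (rule ccontr)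
    assume "\<not> support Z \<subseteq> insert (e 0) B"
    then obtain f where f: "Z f \<noteq> 0" "f \<noteq> e 0" "f \<notin> B"
      by (auto simp: support_def)
    have fne: "f \<noteq> e i" if "i \<le> k" for i
      using f Z(2)[of i] that by (cases "i = 0") auto
    have "f \<notin> D"
      unfolding bij_betw_imp_surj_on[OF e, symmetric] using fne by (metis atLeastAtMost_iff imageE)
    then have "X f = 0"
      using f(3) by (auto simp: D_def support_def)
    have "V i f = 0" if "i \<le> k" for i
      using \<open>X f = 0\<close> V_supp[of i] fne[of i] f(3) that by (cases "i = 0") (auto simp: V0 support_def)
    then have "hypersum (\<lambda>i. V i f) {0..k} = {0}"
      by (intro hypersum_zero) auto
    then show False
      using f(1) Z(3)[of f] by auto
  qed
  then have Z_eq: "Z = Z (e 0) \<odot> fv B (e 0)"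
    using eq_scaled_fundamental_vector[OF B enB[of 0] Z(1)] by simp
  \<comment> \<open>Only \<open>V 0\<close> is nonzero at \<open>e 0\<close>, so the hypersum is
    single-valued there and fixes the scalar in \<open>Z_eq\<close>.\<close>
  have "hypersum (\<lambda>i. V i (e 0)) {0..k} = {V 0 (e 0)}"
    using notin[of 0] by (intro hypersum_single) (auto simp: support_def)
  then have "Z (e 0) = X (e 0)"
    using Z(3)[of "e 0"] by (simp add: V0)
  then have "Z = Y 0"
    using Z_eq by (simp add: Y_def)
  have split: "{0..k} = insert 0 {1..k}"
    by auto
  have "Y 0 \<in> hypersum V (insert 0 {1..k})"
    using Z(3) \<open>Z = Y 0\<close> by (simp add: hypersum_fun_iff split)
  then have "X \<in> hypersum Y {0..k}"
    using hypersum_exchange[of "{1..k}" 0 Y V] by (simp add: V0 V_def split)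
  also have "hypersum Y {0..k} = hypersum (\<lambda>f. X f \<odot> fv B f) D"
    unfolding Y_def by (rule hypersum_reindex[OF e])
  also have "\<dots> = hypersum (\<lambda>f. X f \<odot> fv B f) (UNIV - B)"
    by (rule hypersum_mono_neutral[symmetric]) (auto simp: D_def support_def scale_zero_left)
  finally show ?thesis
    unfolding linear_span_def by blast
qed

section \<open>From expansions in fundamental vectors to strong modular elimination\<close>

lemma linear_span_coefficients:
  assumes B: "basis B" and X: "X \<in> linear_span (fv B) (UNIV - B)"
  shows "X \<in> hypersum (\<lambda>f. X f \<odot> fv B f) (UNIV - B)"
proof -
  obtain c where c: "X \<in> hypersum (\<lambda>f. c f \<odot> fv B f) (UNIV - B)"
    using X by (auto simp: linear_span_def)
  \<comment> \<open>At \<open>f\<close> outside \<open>B\<close> all other fundamental vectors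
    vanish and that of \<open>f\<close> is \<open>1\<close>, so the coefficient can be read off as
    an entry of \<open>X\<close>.\<close>
  have "X f = c f" if "f \<notin> B" for f
  proof -
    have "X f \<in> hypersum (\<lambda>g. (c g \<odot> fv B g) f) (UNIV - B)"
      using c by (simp add: hypersum_fun_iff)
    also have "\<dots> = {(c f \<odot> fv B f) f}"
      using that fundamental_vector_eq_0[OF B] by (intro hypersum_single) (auto simp: scale_apply)
    finally show ?thesis
      using fundamental_vector(2)[OF B that] by (simp add: scale_apply)
  qed
  then show ?thesis
    using c hypersum_cong[of "UNIV - B" "UNIV - B" "\<lambda>f. c f \<odot> fv B f" "\<lambda>f. X f \<odot> fv B f"] by simp
qed

text \<open>A circuit avoiding \<open>{e 0, \<dots>, e k}\<close> would be the first step of a chain of length \<open>k + 2\<close>.\<close>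

lemma indep_modular_family_diff:
  fixes k :: nat
  assumes mod: "modular_family \<C> X {0..k}"
    and e0: "e 0 \<in> support (X 0)" "\<And>i. 1 \<le> i \<Longrightarrow> i \<le> k \<Longrightarrow> e 0 \<notin> support (X i)"
    and e: "\<And>i. 1 \<le> i \<Longrightarrow> i \<le> k \<Longrightarrow> e i \<in> support (X i)"
      "\<And>i j. 1 \<le> i \<Longrightarrow> i \<le> k \<Longrightarrow> 1 \<le> j \<Longrightarrow> j \<le> k \<Longrightarrow> i \<noteq> j \<Longrightarrow> e i \<notin> support (X j)"
  shows "indep ((\<Union>i\<in>{0..k}. support (X i)) - e ` {0..k})"
proof (rule ccontr)
  let ?A = "\<Union>i\<in>{0..k}. support (X i)"
  assume "\<not> indep (?A - e ` {0..k})"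
  then obtain C where C: "circuit C" "C \<subseteq> ?A - e ` {0..k}"
    using dependent_contains_circuit by blast
  obtain W where W: "W \<in> \<C>" "support W = C"
    using circuit_is_support C(1) by blast
  \<comment> \<open>The order is \<open>W, X 1, \<dots>, X k, X 0\<close>. As \<open>W\<close>
    avoids every \<open>e i\<close>, each later vector still contributes its own \<open>e i\<close>,
    with \<open>e 0\<close> belonging to \<open>X 0\<close> at the end.\<close>
  define Y where "Y i = (if i = 0 then W else if i = Suc k then X 0 else X i)" for i
  have "strict_chain (support_unions \<C>) (\<lambda>i. \<Union>j<i. support (Y j)) (Suc (Suc k))"
  proof (rule strict_chain_partial_unions)
    fix i assume i: "i < Suc (Suc k)"
    show "Y i \<in> \<C>"
      using i mod W(1) by (auto simp: Y_def modular_family_def)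
    show "\<not> support (Y i) \<subseteq> (\<Union>j<i. support (Y j))"
    proof (cases "i = 0")
      case True
      then show ?thesis
        using support_nonempty[OF W(1)] by (simp add: Y_def)
    next
      case False
      let ?i = "if i = Suc k then 0 else i"
      have "e ?i \<in> support (Y i)"
        using False i e0(1) e(1) by (simp add: Y_def)
      moreover have "e ?i \<notin> support (Y j)" if "j < i" for j
        using that i False e0(2)[of j] e(2)[of i j] C(2) W(2) by (auto simp: Y_def)
      ultimately show ?thesis
        by blast
    qed
  qed
  moreover have "(\<Union>j<Suc (Suc k). support (Y j)) = ?A"
  proof (intro equalityI UN_least)
    show "support (Y j) \<subseteq> ?A" if j: "j \<in> {..<Suc (Suc k)}" for j
    proof -
      have "support (X i) \<subseteq> ?A" if "i \<le> k" for i
        using that by (intro UN_upper) simp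
      moreover have "support W \<subseteq> ?A"
        using C(2) W(2) by blast
      moreover have "j \<le> k" if "j \<noteq> Suc k"
        using j that by simp
      ultimately show ?thesis
        by (cases "j = 0"; cases "j = Suc k") (simp_all add: Y_def)
    qed
    show "support (X j) \<subseteq> (\<Union>j<Suc (Suc k). support (Y j))" if "j \<in> {0..k}" for j
    proof -
      let ?j = "if j = 0 then Suc k else j"
      have "Y ?j = X j" "?j < Suc (Suc k)"
        using that by (auto simp: Y_def)
      then show ?thesis
        by (metis UN_upper lessThan_iff)
    qed
  qed
  ultimately have "Suc (Suc k) \<le> height (support_unions \<C>) ?A"
    by (rule height_ge)
  then show False
    using mod by (simp add: modular_family_def)
qed

lemma strong_modular_elimination_of_span:
  assumes span: "\<And>X B. X \<in> \<C> \<Longrightarrow> basis B \<Longrightarrow> X \<in> linear_span (fv B) (UNIV - B)"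
  shows "strong_modular_elimination \<C>"
  unfolding strong_modular_elimination_def
proof (intro allI impI)
  fix k :: nat and X :: "nat \<Rightarrow> 'e \<Rightarrow> 'f" and e :: "nat \<Rightarrow> 'e"
  assume mod: "modular_family \<C> X {0..k}"
    and nsub: "\<not> support (X 0) \<subseteq> (\<Union>i\<in>{1..k}. support (X i))"
    and H: "\<forall>i\<in>{1..k}. e i \<in> (support (X 0) \<inter> support (X i)) - (\<Union>j\<in>{1..k} - {i}. support (X j))
           \<and> X 0 (e i) = - X i (e i) \<and> - X i (e i) \<noteq> 0"
  obtain x where x: "x \<in> support (X 0)" "x \<notin> (\<Union>i\<in>{1..k}. support (X i))"
    using nsub by blast
  \<comment> \<open>The elimination axiom leaves \<open>e 0\<close> unconstrained; that index now
    holds the element private to \<open>X 0\<close>.\<close>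
  define d where "d = e(0 := x)"
  have d0: "d 0 = x"
    by (simp add: d_def)
  have de: "d i = e i" if "1 \<le> i" for i
    using that by (auto simp: d_def)
  have X_in: "X i \<in> \<C>" if "i \<le> k" for i
    using mod that by (auto simp: modular_family_def)
  have dX: "d i \<in> support (X i)" if "i \<le> k" for i
    using H x(1) that by (cases "i = 0") (auto simp: d0 de)
  have notin: "d i \<notin> support (X j)" if "i \<le> k" "1 \<le> j" "j \<le> k" "i \<noteq> j" for i j
    using H x(2) that by (cases "i = 0") (auto simp: d0 de)
  have inj: "inj_on d {0..k}"
  proof (rule linorder_inj_onI')
    fix i j assume "i \<in> {0..k}" "j \<in> {0..k}" "i < j"
    then show "d i \<noteq> d j"
      using notin[of i j] dX[of j] by auto
  qed
  define A where "A = (\<Union>i\<in>{0..k}. support (X i))"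
  have "indep (A - d ` {0..k})"
    unfolding A_def by (rule indep_modular_family_diff[OF mod]) (use dX notin in auto)
  then obtain B where B: "basis B" "A - d ` {0..k} \<subseteq> B"
    using indep_extends_to_basis by blast
  have "indep B"
    using B(1) by (simp add: basis_def)
  have supp: "support (X i) \<subseteq> insert (d i) B" if "1 \<le> i" "i \<le> k" for i
  proof
    fix y assume y: "y \<in> support (X i)"
    then have "y \<in> A"
      using that by (auto simp: A_def)
    moreover have "y \<noteq> d j" if "j \<le> k" "j \<noteq> i" for j
      using notin[of j i] y that \<open>1 \<le> i\<close> \<open>i \<le> k\<close> by blast
    then have "y \<notin> d ` {0..k} \<or> y = d i"
      by (metis atLeastAtMost_iff imageE)
    ultimately show "y \<in> insert (d i) B"
      using B(2) by blast
  qed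
  have dnB: "d i \<notin> B" if "1 \<le> i" "i \<le> k" for i
    using supp[OF that] indep_no_circuit[OF \<open>indep B\<close> circuit_support[OF X_in[OF that(2)]]]
    by (auto simp: insert_absorb)
  have X_eq: "X i = X i (d i) \<odot> fv B (d i)" if "1 \<le> i" "i \<le> k" for i
    using eq_scaled_fundamental_vector[OF B(1) dnB[OF that] X_in[OF that(2)] supp[OF that]] .
  have outside: "X 0 f = 0" if "f \<notin> B" "f \<notin> d ` {0..k}" for f
  proof -
    have "support (X 0) \<subseteq> A"
      unfolding A_def by (intro UN_upper) simp
    then show ?thesis
      using that B(2) by (auto simp: support_def)
  qed
  have X0: "X 0 \<in> hypersum (\<lambda>f. X 0 f \<odot> fv B f) (UNIV - B)"
    using linear_span_coefficients[OF B(1) span[OF X_in[of 0] B(1)]] by simp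
  have "d 0 \<notin> B"
  proof
    assume "d 0 \<in> B"
    have "X 0 (d 0) \<in> hypersum (\<lambda>f. (X 0 f \<odot> fv B f) (d 0)) (UNIV - B)"
      using X0 by (simp add: hypersum_fun_iff)
    also have "\<dots> = {0}"
    proof (rule hypersum_zero)
      fix f assume f: "f \<in> UNIV - B"
      show "(X 0 f \<odot> fv B f) (d 0) = 0"
      proof (cases "f \<in> d ` {0..k}")
        case True
        then obtain i where i: "i \<le> k" "f = d i"
          by auto
        have "1 \<le> i"
          using f i \<open>d 0 \<in> B\<close> by (cases "i = 0") auto
        have "X i (d 0) = 0"
          using notin[of 0 i] \<open>1 \<le> i\<close> i(1) by (simp add: support_def)
        moreover have "X i (d i) \<noteq> 0"
          using dX[OF i(1)] by (simp add: support_def)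
        ultimately have "fv B f (d 0) = 0"
          using fun_cong[OF X_eq[OF \<open>1 \<le> i\<close> i(1)], of "d 0"] i(2) by (simp add: scale_apply)
        then show ?thesis
          by (simp add: scale_apply)
      next
        case False
        then show ?thesis
          using outside f by (simp add: scale_apply)
      qed
    qed simp
    finally show False
      using dX[of 0] by (simp add: support_def)
  qed
  then have dnB': "d i \<notin> B" if "i \<le> k" for i
    using dnB[of i] that by (cases "i = 0") auto
  define Y where "Y i = X 0 (d i) \<odot> fv B (d i)" for i
  \<comment> \<open>The prescribed values \<open>X 0 (e i) = - X i (e i)\<close> make each expansion
    term the negative of a given vector.\<close>
  have Y_eq: "Y i = - X i" if "1 \<le> i" "i \<le> k" for i
  proof -
    have "Y i = (- X i (d i)) \<odot> fv B (d i)"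
      using H that by (simp add: Y_def de)
    then show ?thesis
      using X_eq[OF that] by (simp add: scale_minus_left)
  qed
  have split: "{0..k} = insert 0 {1..k}"
    by auto
  have "hypersum (\<lambda>f. X 0 f \<odot> fv B f) (UNIV - B) = hypersum (\<lambda>f. X 0 f \<odot> fv B f) (d ` {0..k})"
    using dnB' outside by (intro hypersum_mono_neutral) (auto simp: scale_zero_left)
  also have "\<dots> = hypersum Y {0..k}"
    unfolding Y_def using inj by (intro hypersum_reindex[symmetric]) (simp add: bij_betw_def)
  finally have "X 0 \<in> hypersum Y (insert 0 {1..k})"
    using X0 by (simp add: split)
  then have "Y 0 \<in> hypersum X {0..k}"
    using hypersum_exchange[of "{1..k}" 0 X Y] Y_eq by (simp add: split)
  moreover have "Y 0 \<in> \<C>"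
    using dX[of 0] fundamental_vector(1)[OF B(1) \<open>d 0 \<notin> B\<close>] scale_in by (simp add: Y_def support_def)
  moreover have "Y 0 (e i) = 0" if "i \<in> {1..k}" for i
  proof -
    have "d i \<noteq> d 0"
      using inj that by (simp add: inj_on_eq_iff)
    then show ?thesis
      using fundamental_vector_eq_0[OF B(1) \<open>d 0 \<notin> B\<close> dnB'[of i]] that
      by (simp add: Y_def scale_apply de)
  qed
  ultimately show "\<exists>Z\<in>\<C>. (\<forall>i\<in>{1..k}. Z (e i) = 0) \<and> (\<forall>f. Z f \<in> hypersum (\<lambda>i. X i f) {0..k})"
    by (intro bexI[of _ "Y 0"]) (auto simp: hypersum_fun_iff)
qed

end

theorem theorem3p8:
  fixes \<C> :: "('e::finite \<Rightarrow> 'f::hyperfield) set"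
  assumes C0: "0 \<notin> \<C>"
    and C1: "\<And>X \<alpha>. X \<in> \<C> \<Longrightarrow> \<alpha> \<noteq> 0 \<Longrightarrow> \<alpha> \<odot> X \<in> \<C>"
    and C2: "\<And>X Y. X \<in> \<C> \<Longrightarrow> Y \<in> \<C> \<Longrightarrow> support X \<subseteq> support Y \<Longrightarrow> \<exists>\<alpha>. \<alpha> \<noteq> 0 \<and> X = \<alpha> \<odot> Y"
  shows "strong_modular_elimination \<C> \<longleftrightarrow> spanned_by_fundamental_vectors \<C>"
proof
  interpret circuit_vectors \<C>
    by unfold_locales (fact C0 C1 C2)+
  assume SME: "strong_modular_elimination \<C>"
  \<comment> \<open>Independence has to mean containing no support if the supports are to be the
    circuits.\<close>
  let ?indep = "\<lambda>I. \<forall>D\<in>support ` \<C>. \<not> D \<subseteq> I"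
  have mat: "matroid UNIV ?indep"
  proof (rule matroid_of_circuits)
    show "{} \<notin> support ` \<C>"
      using support_nonempty by auto
  next
    fix C D e
    assume CD: "C \<in> support ` \<C>" "D \<in> support ` \<C>" "C \<noteq> D" "e \<in> C \<inter> D"
    from CD(1,2) obtain X Y where XY: "X \<in> \<C>" "Y \<in> \<C>" "C = support X" "D = support Y"
      by blast
    obtain Z where "Z \<in> \<C>" "support Z \<subseteq> (support X \<union> support Y) - {e}"
      using circuit_elimination[OF SME XY(1,2) CD(3,4)[unfolded XY(3,4)]] by (elim bexE)
    then show "\<exists>Z\<in>support ` \<C>. Z \<subseteq> (C \<union> D) - {e}"
      unfolding XY(3,4) by blast
  qed
  have circ: "support ` \<C> = {C. matroid.circuit UNIV ?indep C}"
  proof (rule circuit_of_circuits[OF mat, symmetric])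
    fix C D
    assume "C \<in> support ` \<C>" "D \<in> support ` \<C>" "C \<subseteq> D"
    then obtain X Y where XY: "X \<in> \<C>" "Y \<in> \<C>" "C = support X" "D = support Y"
      by blast
    show "C = D"
      using support_antichain[OF XY(1,2)] \<open>C \<subseteq> D\<close> unfolding XY(3,4) by blast
  qed
  interpret M: matroid UNIV ?indep
    by (rule mat)
  interpret circuit_vectors_of_matroid \<C> ?indep
    by unfold_locales (rule circ)
  show "spanned_by_fundamental_vectors \<C>"
    unfolding spanned_by_fundamental_vectors_def
  proof (intro exI[of _ ?indep] conjI ballI allI impI)
    show "X \<in> linear_span (fundamental_vector ?indep \<C> B) (UNIV - B)"
      if "X \<in> \<C>" "matroid.basis ?indep B" for X B
      by (rule in_span_of_fundamental_vectors[OF SME that])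
  qed (fact mat circ)+
next
  assume "spanned_by_fundamental_vectors \<C>"
  then obtain indep where mat: "matroid UNIV indep"
    and circ: "support ` \<C> = {C. matroid.circuit UNIV indep C}"
    and span: "\<forall>X\<in>\<C>. \<forall>B. matroid.basis indep B \<longrightarrow>
      X \<in> linear_span (fundamental_vector indep \<C> B) (UNIV - B)"
    unfolding spanned_by_fundamental_vectors_def by (elim exE conjE) (rule that)
  interpret matroid UNIV indep
    by (rule mat)
  interpret circuit_vectors_of_matroid \<C> indep
    by unfold_locales (fact C0 C1 C2 circ)+
  show "strong_modular_elimination \<C>"
    using strong_modular_elimination_of_span span by simp
qed

end
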